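(* Let $n$ be a natural number and $k>2$ an integer such that $\sigma(n)=k\cdot n$ (i.e. $n$ is $k$-multiperfect). Then $e^{k-\gamma} < \tau(n)$, where $\gamma$ is the Euler–Mascheroni constant.
   Context: $\sigma(n)=\sum_{d\mid n} d$ is the sum of the positive divisors of $n$, and $\tau(n)=\sum_{d\mid n}1$ is the number of positive divisors of $n$. A natural number $n$ is called $k$-multiperfect if $\sigma(n)=k\cdot n$ for some integer $k>2$. $\gamma = \lim_{m\to\infty}\big(\sum_{i=1}^m \frac1i - \ln m\big)$. *)

theory Defs
  imports "HOL-Analysis.Harmonic_Numbers"
begin

text \<open>
  Both functions are meant for positive arguments: every number divides \<open>0\<close>, so at \<open>0\<close> the index
  set is infinite and both take the junk value \<open>0\<close>.
\<close>

definition divisor_sigma :: "nat \<Rightarrow> nat" where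
  "divisor_sigma n = (\<Sum>d | d dvd n. d)"

definition divisor_tau :: "nat \<Rightarrow> nat" where
  "divisor_tau n = (\<Sum>d | d dvd n. 1)"

end

theory Submission
  imports Defs
begin

text \<open>
  Here \<open>k = \<sigma>(n)/n\<close> is the sum of the reciprocals of the \<open>m = \<tau>(n)\<close> divisors of \<open>n\<close>. Comparing the
  divisors other than \<open>n\<close> with \<open>1, \<dots>, m - 1\<close> gives \<open>k \<le> H\<^sub>m\<^sub>-\<^sub>1 + 1/n\<close>, while
  \<open>H\<^sub>m\<^sub>-\<^sub>1 + 1/(2m) \<le> ln m + \<gamma>\<close>. So it suffices that \<open>2m < n\<close>. This holds as soon as \<open>m \<ge> 7\<close>, because
  all divisors except \<open>n\<close> and possibly \<open>n/2\<close> are at most \<open>n/3\<close>; and \<open>3 \<le> k \<le> H\<^sub>m\<close> forces \<open>m \<ge> 7\<close>.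
\<close>

text \<open>Induction removing the largest element \<open>b\<close>: as the set lies in
  \<open>{1..b}\<close>, \<open>b\<close> is at least its cardinality.\<close>

lemma sum_inverse_le_harm_card:
  fixes A :: "nat set"
  assumes "finite A" "0 \<notin> A"
  shows "(\<Sum>d\<in>A. inverse (real d)) \<le> harm (card A)"
  using assms
proof (induction A rule: finite_linorder_max_induct)
  case empty
  then show ?case by (simp add: harm_def)
next
  case (insert b A)
  have "b \<notin> A"
    using insert.hyps by auto
  have "x \<in> {1..b}" if "x \<in> insert b A" for x
  proof -
    have "x \<noteq> 0"
      using that insert.prems by metis
    then show ?thesis
      using that insert.hyps(2) by (auto intro: less_imp_le)
  qed
  then have "insert b A \<subseteq> {1..b}"
    by blast
  then have "card (insert b A) \<le> b"
    using card_mono[of "{1..b}"] by simp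
  then have "inverse (real b) \<le> inverse (real (Suc (card A)))"
    using \<open>b \<notin> A\<close> insert.hyps by (intro le_imp_inverse_le) auto
  moreover have "(\<Sum>d\<in>A. inverse (real d)) \<le> harm (card A)"
    using insert.IH insert.prems by simp
  ultimately show ?case
    using \<open>b \<notin> A\<close> insert.hyps(1) by (simp add: harm_Suc del: of_nat_Suc)
qed

lemma divisor_tau_eq_card: "divisor_tau n = card {d. d dvd n}"
  by (simp add: divisor_tau_def)

lemma sum_inverse_divisors:
  assumes "n > 0"
  shows "(\<Sum>d | d dvd n. inverse (real d)) = real (divisor_sigma n) / real n"
proof -
  \<comment> \<open>The involution \<open>d\<close> to \<open>n div d\<close> permutes the
    divisors.\<close>
  have "(\<Sum>d | d dvd n. inverse (real d)) = (\<Sum>d | d dvd n. real d / real n)"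
    by (rule sum.reindex_bij_witness[of _ "\<lambda>d. n div d" "\<lambda>d. n div d"])
       (use assms in \<open>auto simp: real_of_nat_div inverse_eq_divide dvd_div_eq_mult\<close>)
  then show ?thesis
    by (simp add: divisor_sigma_def sum_divide_distrib)
qed

lemma divisor_tau_le:
  assumes "n > 0"
  shows "divisor_tau n \<le> n div 3 + 2"
proof -
  \<comment> \<open>Split on the cofactor \<open>q = n / d\<close>. For odd \<open>n\<close> the
    element \<open>n div 2\<close> is merely harmless, since only an inclusion is claimed.\<close>
  have "d \<in> {1..n div 3} \<union> {n, n div 2}" if "d dvd n" for d
  proof -
    obtain q where q: "n = d * q"
      using \<open>d dvd n\<close> by auto
    with assms have "d \<ge> 1" "q \<ge> 1" by auto
    then consider "q = 1" | "q = 2" | "3 \<le> q" by linarith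
    then show ?thesis
    proof cases
      case 3
      then have "d * 3 \<le> n" using q by simp
      then have "d \<le> n div 3" by (simp add: less_eq_div_iff_mult_less_eq)
      with \<open>d \<ge> 1\<close> show ?thesis by simp
    qed (use q in auto)
  qed
  then have "{d. d dvd n} \<subseteq> {1..n div 3} \<union> {n, n div 2}"
    by blast
  then have "divisor_tau n \<le> card ({1..n div 3} \<union> {n, n div 2})"
    unfolding divisor_tau_eq_card by (intro card_mono) simp_all
  also have "\<dots> \<le> card {1..n div 3} + card {n, n div 2}"
    by (rule card_Un_le)
  also have "\<dots> \<le> n div 3 + 2"
    by (simp add: card_insert_if)
  finally show ?thesis .
qed

theorem theorem2:
  fixes n :: nat and k :: int
  assumes "n > 0"
    and "k > 2"
    and "int (divisor_sigma n) = k * int n"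
  shows "exp (real_of_int k - euler_mascheroni) < real (divisor_tau n)"
proof -
  define m where "m = divisor_tau n"
  have fin: "finite {d. d dvd n}"
    using assms(1) by simp
  have "real (divisor_sigma n) = real_of_int k * real n"
    using assms(3) by (metis of_int_mult of_int_of_nat_eq)
  then have k: "real_of_int k = (\<Sum>d | d dvd n. inverse (real d))"
    using assms(1) by (simp add: sum_inverse_divisors)
  \<comment> \<open>7 is the least \<open>m\<close> with \<open>3 * (m - 2) > 2 * m\<close>, which
    the deduction of \<open>2 * m < n\<close> requires.\<close>
  have "m \<ge> 7"
  proof (rule ccontr)
    assume "\<not> m \<ge> 7"
    have "3 \<le> real_of_int k"
      using assms(2) by linarith
    also have "\<dots> \<le> harm m"
      unfolding k m_def divisor_tau_eq_card
      using assms(1) fin by (intro sum_inverse_le_harm_card) auto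
    also have "\<dots> \<le> harm 6"
      using \<open>\<not> m \<ge> 7\<close> by (intro harm_mono) simp
    also have "\<dots> < (3 :: real)"
      by (simp add: harm_expand)
    finally show False by simp
  qed
  moreover have "m \<le> n div 3 + 2"
    unfolding m_def using assms(1) by (rule divisor_tau_le)
  ultimately have "2 * m < n" by linarith
  \<comment> \<open>The term for \<open>n\<close> is kept exact: \<open>harm m\<close> exceeds
    \<open>ln m\<close> + \<gamma>, so bounding all \<open>m\<close> terms at once would lose too
    much.\<close>
  have "(\<Sum>d\<in>{d. d dvd n} - {n}. inverse (real d)) \<le> harm (m - 1)"
    using sum_inverse_le_harm_card[of "{d. d dvd n} - {n}"] assms(1) fin
    by (simp add: m_def divisor_tau_eq_card)
  then have "real_of_int k \<le> harm (m - 1) + inverse (real n)"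
    unfolding k using fin by (subst sum.remove[of _ n]) auto
  also have "\<dots> < harm (m - 1) + inverse (real (2 * m))"
    using \<open>2 * m < n\<close> \<open>m \<ge> 7\<close> by (intro add_strict_left_mono less_imp_inverse_less) auto
  also have "\<dots> \<le> ln (real m) + euler_mascheroni"
  proof -
    \<comment> \<open>The library bound at index \<open>i\<close> involves
      \<open>harm (Suc i)\<close> and \<open>ln (i + 2)\<close>, hence
      \<open>i = m - 2\<close>.\<close>
    have "Suc (m - 2) = m - 1" "m - 2 + 2 = m"
      using \<open>m \<ge> 7\<close> by auto
    then show ?thesis
      using euler_mascheroni_lower[of "m - 2"] by (simp add: inverse_eq_divide)
  qed
  finally have "exp (real_of_int k - euler_mascheroni) < exp (ln (real m))"
    by simp
  also have "\<dots> = real m"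
    using \<open>m \<ge> 7\<close> by simp
  finally show ?thesis
    by (simp add: m_def)
qed

end
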